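(* Let $u>0$, $k\in\mathbb N$, $q\in\mathbb N=\{1,2,\dots\}$, and let $n_1,\dots,n_k\in\mathbb N_0$ be such that $n_1+\dots+n_k=q$. For $N_1,\dots,N_k$ i.i.d. standard Gaussian random variables, let $$\alpha_{2n_1,\dots,2n_k}(u)=\mathbb E\Big[\mathbf 1_{\{\sum_{j=1}^kN_j^2\ge u\}}\prod_{j=1}^kH_{2n_j}(N_j)\Big].$$ Then for $k=1$ $$\alpha_{2n_1}(u)=2\,\phi(\sqrt u)\,H_{2n_1-1}(\sqrt u),$$ while for $k\ge2$ $$\alpha_{2n_1,\dots,2n_k}(u)=-\sum_{0\le r_1\le n_1,\dots,0\le r_k\le n_k}\frac{(-1)^{r_1+\dots+r_k}}{2^{n_1}\cdots2^{n_k}}\,\frac{(2n_1)!\cdots(2n_k)!}{r_1!(n_1-r_1)!\cdots r_k!(n_k-r_k)!}\cdot\frac{\gamma\big(\frac k2+n_1-r_1+\dots+n_k-r_k,\frac u2\big)}{\Gamma\big(\frac k2+n_1-r_1+\dots+n_k-r_k\big)}.$$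
   Context: $\phi$ is the standard Gaussian density. $H_n$ are the (probabilists') Hermite polynomials: $H_0=1$ and $H_n(r)=(-1)^n\phi(r)^{-1}\frac{d^n}{dr^n}\phi(r)$ for $n\ge1$. $\Gamma$ is the Gamma function and $\gamma(a,x)=\int_0^xt^{a-1}e^{-t}\,dt$ is the lower incomplete Gamma function. $\mathbb N_0=\{0,1,2,\dots\}$. *)

theory Defs
  imports "HOL-Probability.Probability"
begin

definition hermite :: "nat \<Rightarrow> real \<Rightarrow> real" where
  "hermite n r =
     (if n = 0 then 1
      else (-1) ^ n * inverse (std_normal_density r) * (deriv ^^ n) std_normal_density r)"

(* Meant for a > 0 and x >= 0; outside this range the integral defaults to 0. *)
definition lower_Gamma :: "real \<Rightarrow> real \<Rightarrow> real" where
  "lower_Gamma a x = integral {0..x} (\<lambda>t. t powr (a - 1) * exp (- t))"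

definition iid_std_normal :: "'a measure \<Rightarrow> nat \<Rightarrow> (nat \<Rightarrow> 'a \<Rightarrow> real) \<Rightarrow> bool" where
  "iid_std_normal M k N \<longleftrightarrow>
     prob_space M \<and>
     prob_space.indep_vars M (\<lambda>_. borel) N {1..k} \<and>
     (\<forall>j\<in>{1..k}. distributed M lborel (N j) std_normal_density)"

(* alpha_{2 n_1, ..., 2 n_k}(u); the argument n lists the n_j, not the even indices 2 n_j. *)
definition alpha_coeff ::
    "'a measure \<Rightarrow> nat \<Rightarrow> (nat \<Rightarrow> 'a \<Rightarrow> real) \<Rightarrow> (nat \<Rightarrow> nat) \<Rightarrow> real \<Rightarrow> real" where
  "alpha_coeff M k N n u =
     (\<integral>\<omega>. indicator {\<omega>. (\<Sum>j=1..k. (N j \<omega>)\<^sup>2) \<ge> u} \<omega> *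
           (\<Prod>j=1..k. hermite (2 * n j) (N j \<omega>)) \<partial>M)"

end

theory Submission
  imports Defs
begin

text \<open>
  The event \<open>\<Sum> N\<^sub>j\<^sup>2 \<ge> u\<close> is replaced by its complement: since some \<open>n\<^sub>j\<close> is positive,
  the product of the Hermite polynomials of degree \<open>2n\<^sub>j\<close> at \<open>N\<^sub>j\<close> has expectation 0
  (\<open>sum_hermite_coeff_even_moment\<close>), so the coefficient is minus the expectation over
  \<open>\<Sum> N\<^sub>j\<^sup>2 < u\<close>.

  Expand each Hermite polynomial into even monomials (\<open>hermite_even_expansion\<close>). It remains to
  compute \<open>E[1{\<Sum> N\<^sub>j\<^sup>2 / 2 < v} \<Prod> N\<^sub>j ^ (2m\<^sub>j)]\<close> for \<open>v = u/2\<close>. Weighting a standard normal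
  variable by its \<open>2m\<close>-th power makes half of its square Gamma distributed with shape \<open>m + 1/2\<close>,
  up to the factor \<open>(2m)! / (2^m m!)\<close>, the moment of order \<open>2m\<close>
  (\<open>std_normal_truncated_moment\<close>). Gamma densities convolve by adding the shapes, by the Beta
  integral (\<open>gamma_density_convolution\<close>). Hence the truncated mixed moment is the product of the
  moments times the Gamma distribution function with shape \<open>k/2 + \<Sum> m\<^sub>j\<close> at \<open>u/2\<close>
  (\<open>std_normal_vector_truncated_moment\<close>), and multiplying by the Hermite coefficients gives the
  formula.

  For \<open>k = 1\<close> the complementary expectation is the integral of \<open>H\<^bsub>2n\<^esub> \<phi>\<close> over
  \<open>[-\<surd>u, \<surd>u]\<close>, and \<open>- H\<^bsub>2n-1\<^esub> \<phi>\<close> is an odd antiderivative of the integrand.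
\<close>

section \<open>Hermite polynomials\<close>

text \<open>The \<open>n\<close>-th probabilists' Hermite polynomial, defined by the recursion that
  differentiation of \<open>poly p x * std_normal_density x\<close> induces, up to sign, on the polynomial factor.\<close>

fun hermite_poly :: "nat \<Rightarrow> real poly" where
  "hermite_poly 0 = 1"
| "hermite_poly (Suc n) = [:0, 1:] * hermite_poly n - pderiv (hermite_poly n)"

lemma has_real_derivative_std_normal_density:
  "(std_normal_density has_real_derivative - x * std_normal_density x) (at x)"
  unfolding std_normal_density_def [abs_def]
  by (auto intro!: derivative_eq_intros simp: field_simps power2_eq_square)

lemma has_real_derivative_hermite_poly_density:
  "((\<lambda>x. poly (hermite_poly n) x * std_normal_density x) has_real_derivative
     - (poly (hermite_poly (Suc n)) x * std_normal_density x)) (at x)"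
  by (rule derivative_eq_intros poly_DERIV has_real_derivative_std_normal_density refl)+
     (simp add: algebra_simps)

lemma higher_deriv_std_normal_density:
  "(deriv ^^ n) std_normal_density =
     (\<lambda>x. (-1) ^ n * (poly (hermite_poly n) x * std_normal_density x))"
proof (induction n)
  case (Suc n)
  have "((\<lambda>x. (-1) ^ n * (poly (hermite_poly n) x * std_normal_density x)) has_real_derivative
     (-1) ^ Suc n * (poly (hermite_poly (Suc n)) x * std_normal_density x)) (at x)" for x
    using DERIV_cmult [OF has_real_derivative_hermite_poly_density, of "(-1) ^ n" n x] by simp
  then show ?case
    using Suc by (auto simp del: hermite_poly.simps intro!: ext DERIV_imp_deriv)
qed simp

lemma hermite_eq_poly: "hermite n x = poly (hermite_poly n) x"
proof (cases "n = 0")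
  case False
  have "hermite n x = ((-1) ^ n * (-1) ^ n) * poly (hermite_poly n) x
          * (inverse (std_normal_density x) * std_normal_density x)"
    using False by (simp add: hermite_def higher_deriv_std_normal_density mult_ac)
  also have "\<dots> = poly (hermite_poly n) x"
    using normal_density_pos [of 1 0 x] by (simp flip: power_mult_distrib)
  finally show ?thesis .
qed (simp add: hermite_def)

text \<open>The Hermite polynomials form an Appell sequence. This determines them by their constant terms:
  comparing coefficients reduces the coefficient of \<open>x ^ i\<close> in degree \<open>n + i\<close> to the constant
  term in degree \<open>n\<close>.\<close>

lemma pderiv_hermite_poly: "pderiv (hermite_poly (Suc n)) = of_nat (Suc n) * hermite_poly n"
proof (induction n)
  case 0
  then show ?case by (simp add: pderiv_pCons)
next
  case (Suc n)
  have "pderiv (hermite_poly (Suc (Suc n))) =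
     hermite_poly (Suc n) + [:0, 1:] * pderiv (hermite_poly (Suc n))
       - pderiv (pderiv (hermite_poly (Suc n)))"
    by (subst hermite_poly.simps(2)[of "Suc n"])
       (simp add: pderiv_diff pderiv_mult pderiv_pCons del: hermite_poly.simps)
  also have "\<dots> = hermite_poly (Suc n) + of_nat (Suc n) *
       ([:0, 1:] * hermite_poly n - pderiv (hermite_poly n))"
    unfolding Suc by (simp add: pderiv_mult pderiv_of_nat algebra_simps
      del: hermite_poly.simps of_nat_Suc)
  also have "\<dots> = of_nat (Suc (Suc n)) * hermite_poly (Suc n)"
    by (simp add: algebra_simps)
  finally show ?case .
qed

lemma hermite_poly_Suc_Suc:
  "hermite_poly (Suc (Suc n)) = [:0, 1:] * hermite_poly (Suc n) - of_nat (Suc n) * hermite_poly n"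
  by (subst hermite_poly.simps(2)) (simp only: pderiv_hermite_poly)

lemma coeff_hermite_poly:
  "coeff (hermite_poly (n + i)) i = of_nat ((n + i) choose i) * coeff (hermite_poly n) 0"
proof (induction i)
  case (Suc i)
  have "real (Suc i) * coeff (hermite_poly (n + Suc i)) (Suc i)
          = coeff (pderiv (hermite_poly (Suc (n + i)))) i"
    by (simp add: coeff_pderiv del: hermite_poly.simps)
  also have "\<dots> = real (Suc (n + i)) * coeff (hermite_poly (n + i)) i"
    unfolding pderiv_hermite_poly by (simp add: of_nat_poly del: of_nat_Suc)
  also have "\<dots> = real (Suc (n + i) * ((n + i) choose i)) * coeff (hermite_poly n) 0"
    unfolding Suc by (simp only: of_nat_mult mult.assoc)
  also have "Suc (n + i) * ((n + i) choose i) = Suc i * (Suc (n + i) choose Suc i)"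
    using Suc_times_binomial_eq [of "n + i" i] by (simp only: mult.commute)
  finally show ?case
    by (simp only: of_nat_mult mult.assoc mult_cancel_left of_nat_eq_0_iff) simp
qed simp

lemma coeff_0_hermite_poly_even:
  "coeff (hermite_poly (2 * m)) 0 = (-1) ^ m * fact (2 * m) / (2 ^ m * fact m)"
proof (induction m)
  case (Suc m)
  have "coeff (hermite_poly (2 * Suc m)) 0 = - real (Suc (2 * m)) * coeff (hermite_poly (2 * m)) 0"
    by (simp add: hermite_poly_Suc_Suc coeff_mult_0 of_nat_poly del: hermite_poly.simps of_nat_Suc)
  also have "\<dots> = (-1) ^ Suc m * fact (2 * Suc m) / (2 ^ Suc m * fact (Suc m))"
  proof -
    have "fact (2 * Suc m) = 2 * (real m + 1) * (2 * real m + 1) * fact (2 * m)"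
      by (simp add: algebra_simps)
    then show ?thesis
      unfolding Suc by (simp add: divide_simps del: hermite_poly.simps) (simp add: algebra_simps)
  qed
  finally show ?case .
qed simp

lemma degree_hermite_poly_le: "degree (hermite_poly n) \<le> n"
proof (induction n)
  case (Suc n)
  have "degree ([:0, 1:] * hermite_poly n) \<le> Suc n"
    using Suc by (intro order_trans [OF degree_mult_le]) simp
  moreover have "degree (pderiv (hermite_poly n)) \<le> Suc n"
    using Suc by (simp add: degree_pderiv)
  ultimately show ?case by (simp add: degree_diff_le)
qed simp

lemma poly_hermite_poly_minus:
  "poly (hermite_poly n) (- x) = (-1) ^ n * poly (hermite_poly n) x"
  by (induction n rule: induct_nat_012)
     (simp_all add: hermite_poly_Suc_Suc of_nat_poly algebra_simps
        del: hermite_poly.simps(2) of_nat_Suc, simp)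

text \<open>The coefficient of \<open>x ^ (2 * (n - r))\<close> in the Hermite polynomial of degree \<open>2 * n\<close>,
  for \<open>r \<le> n\<close>. The odd coefficients of this polynomial vanish.\<close>

definition hermite_coeff :: "nat \<Rightarrow> nat \<Rightarrow> real" where
  "hermite_coeff n r = (-1) ^ r * fact (2 * n) / (2 ^ r * fact r * fact (2 * (n - r)))"

lemma hermite_even_expansion:
  "hermite (2 * n) x = (\<Sum>r=0..n. hermite_coeff n r * x ^ (2 * (n - r)))"
proof -
  \<comment> \<open>Hermite polynomials of odd degree are odd functions, so they vanish at 0.\<close>
  have odd0: "coeff (hermite_poly (Suc (2 * m))) 0 = 0" for m
    using poly_hermite_poly_minus [of "Suc (2 * m)" 0] by (simp add: poly_0_coeff_0)
  have eq: "coeff (hermite_poly (2 * n)) i =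
     (2*n choose i) * coeff (hermite_poly (2 * n - i)) 0" if "i \<le> 2 * n" for i
    using coeff_hermite_poly [of "2 * n - i" i] that by simp
  have "hermite (2 * n) x = poly (\<Sum>i\<le>2*n. monom (coeff (hermite_poly (2 * n)) i) i) x"
    by (simp add: hermite_eq_poly poly_as_sum_of_monoms' degree_hermite_poly_le)
  also have "\<dots> = (\<Sum>i\<le>2*n. coeff (hermite_poly (2 * n)) i * x ^ i)"
    by (simp add: poly_sum poly_monom)
  also have "\<dots> = (\<Sum>i\<in>(\<lambda>r. 2 * (n - r)) ` {0..n}. coeff (hermite_poly (2 * n)) i * x ^ i)"
  proof (rule sum.mono_neutral_right)
    show "\<forall>i\<in>{..2 * n} - (\<lambda>r. 2 * (n - r)) ` {0..n}. coeff (hermite_poly (2 * n)) i * x ^ i = 0"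
    proof
      fix i assume i: "i \<in> {..2 * n} - (\<lambda>r. 2 * (n - r)) ` {0..n}"
      have "odd i"
      proof
        assume "even i"
        then obtain m where "i = 2 * m" by blast
        then have "i = 2 * (n - (n - m))" using i by auto
        then show False using i by auto
      qed
      then have "odd (2 * n - i)" using i by auto
      then obtain m where "2 * n - i = Suc (2 * m)" by (metis oddE Suc_eq_plus1)
      then show "coeff (hermite_poly (2 * n)) i * x ^ i = 0"
        using eq [of i] odd0 [of m] i by auto
    qed
  qed auto
  also have "\<dots> = (\<Sum>r=0..n. coeff (hermite_poly (2 * n)) (2 * (n - r)) * x ^ (2 * (n - r)))"
    by (subst sum.reindex) (auto intro!: inj_onI)
  also have "\<dots> = (\<Sum>r=0..n. hermite_coeff n r * x ^ (2 * (n - r)))"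
  proof (rule sum.cong [OF refl])
    fix r assume r: "r \<in> {0..n}"
    have "2 * n - 2 * (n - r) = 2 * r" using r by auto
    then have "coeff (hermite_poly (2 * n)) (2 * (n - r)) = hermite_coeff n r"
      using r eq [of "2 * (n - r)"]
      by (simp add: coeff_0_hermite_poly_even binomial_fact hermite_coeff_def) (simp only: mult_ac)
    then show "coeff (hermite_poly (2 * n)) (2 * (n - r)) * x ^ (2 * (n - r)) =
       hermite_coeff n r * x ^ (2 * (n - r))" by simp
  qed
  finally show ?thesis .
qed

section \<open>Gamma distributions and their convolution\<close>

text \<open>The density of the Gamma distribution with shape \<open>a\<close> and scale 1. The value at
  the single point 0 is immaterial; 0 keeps the support in the positive reals.\<close>

definition gamma_density :: "real \<Rightarrow> real \<Rightarrow> real" where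
  "gamma_density a t = (if t > 0 then t powr (a - 1) * exp (- t) / Gamma a else 0)"

lemma gamma_density_nonneg: "a > 0 \<Longrightarrow> gamma_density a t \<ge> 0"
  by (auto simp: gamma_density_def)

lemma gamma_density_measurable [measurable]: "gamma_density a \<in> borel_measurable borel"
  unfolding gamma_density_def [abs_def] by measurable

text \<open>Gamma densities convolve by adding the shapes: after the substitution \<open>t = w * s\<close> the
  convolution integral becomes a Beta integral.\<close>

lemma gamma_density_convolution:
  assumes a: "a > 0" and b: "b > 0"
  shows "(\<integral>\<^sup>+t. ennreal (gamma_density a t) * ennreal (gamma_density b (w - t)) \<partial>lborel) =
           ennreal (gamma_density (a + b) w)"
proof (cases "w > 0")
  case False
  then have "gamma_density a t * gamma_density b (w - t) = 0" for t
    by (auto simp: gamma_density_def)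
  then have "ennreal (gamma_density a t) * ennreal (gamma_density b (w - t)) = 0" for t
    using gamma_density_nonneg[OF a, of t] gamma_density_nonneg[OF b, of "w - t"]
    by (metis ennreal_0 ennreal_mult)
  then have "(\<integral>\<^sup>+t. ennreal (gamma_density a t) * ennreal (gamma_density b (w - t)) \<partial>lborel) = 0"
    by (simp only: nn_integral_const mult_zero_left)
  then show ?thesis using False by (simp add: gamma_density_def)
next
  case True
  define c where "c = w powr (a + b - 2) * exp (- w) / (Gamma a * Gamma b)"
  have c: "c \<ge> 0" using a b by (simp add: c_def)
  have eq: "gamma_density a (w * s) * gamma_density b (w - w * s) =
      c * (indicator {0..1} s * (s powr (a - 1) * (1 - s) powr (b - 1)))" for s
  proof (cases "0 < s \<and> s < 1")
    case s: True
    have "w * s < w * 1" using s True by (intro mult_strict_left_mono) auto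
    moreover have "w * s > 0" using s True by simp
    moreover have "w - w * s = w * (1 - s)" by (simp add: algebra_simps)
    ultimately have "gamma_density a (w * s) = w powr (a - 1) * s powr (a - 1) * exp (- (w * s)) / Gamma a"
      and "gamma_density b (w - w * s) =
             w powr (b - 1) * (1 - s) powr (b - 1) * exp (- (w * (1 - s))) / Gamma b"
      using s True by (simp_all add: gamma_density_def powr_mult)
    moreover have "exp (- w) = exp (- (w * s)) * exp (- (w * (1 - s)))"
      by (simp add: algebra_simps flip: exp_add)
    moreover have "w powr (a + b - 2) = w powr (a - 1) * w powr (b - 1)"
      by (simp flip: powr_add)
    ultimately show ?thesis
      using s by (simp add: c_def mult_ac)
  next
    case False
    then consider "s \<le> 0" | "s \<ge> 1" by linarith
    then show ?thesis
    proof cases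
      case 1
      then show ?thesis using True
        by (auto simp: gamma_density_def indicator_def zero_less_mult_iff)
    next
      case 2
      then have "w * 1 \<le> w * s" using True by (intro mult_left_mono) auto
      then show ?thesis using 2 by (auto simp: gamma_density_def indicator_def)
    qed
  qed
  have "(\<integral>\<^sup>+t. ennreal (gamma_density a t) * ennreal (gamma_density b (w - t)) \<partial>lborel) =
     ennreal w * (\<integral>\<^sup>+s. ennreal (gamma_density a (w * s)) *
            ennreal (gamma_density b (w - w * s)) \<partial>lborel)"
    using True by (subst nn_integral_real_affine [where c = w and t = 0]) simp_all
  also have "\<dots> = ennreal w * (\<integral>\<^sup>+s. ennreal c *
            ennreal (indicator {0..1} s * (s powr (a - 1) * (1 - s) powr (b - 1))) \<partial>lborel)"
    using c gamma_density_nonneg[OF a] gamma_density_nonneg[OF b]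
    by (simp add: eq flip: ennreal_mult)
  also have "\<dots> = ennreal w * (ennreal c * ennreal (Beta a b))"
    using nn_integral_has_integral_lebesgue[OF _ has_integral_Beta_real[OF a b]]
    by (subst nn_integral_cmult) auto
  also have "\<dots> = ennreal (w * c * Beta a b)"
    using a b c True by (simp add: Beta_def mult.assoc flip: ennreal_mult)
  also have "w * c * Beta a b = gamma_density (a + b) w"
  proof -
    have "w powr (a + b - 1) = w * w powr (a + b - 2)"
      using True powr_add [of w 1 "a + b - 2"] by simp
    moreover have "Gamma a > 0" "Gamma b > 0" using a b by auto
    ultimately show ?thesis
      using True by (simp add: c_def Beta_def gamma_density_def)
  qed
  finally show ?thesis .
qed

text \<open>The same for distribution functions: the mass that the sum of two independent Gamma variables
  puts below \<open>v\<close> is obtained by translating in \<open>s\<close> and exchanging the integrals.\<close>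

lemma gamma_cdf_convolution:
  assumes a: "a > 0" and b: "b > 0"
  shows "(\<integral>\<^sup>+t. (\<integral>\<^sup>+s. indicator {..<v} (s + t) * ennreal (gamma_density b s) \<partial>lborel)
             * ennreal (gamma_density a t) \<partial>lborel) =
         (\<integral>\<^sup>+t. indicator {..<v} t * ennreal (gamma_density (a + b) t) \<partial>lborel)"
proof -
  have "(\<integral>\<^sup>+t. (\<integral>\<^sup>+s. indicator {..<v} (s + t) * ennreal (gamma_density b s) \<partial>lborel)
             * ennreal (gamma_density a t) \<partial>lborel) =
        (\<integral>\<^sup>+t. (\<integral>\<^sup>+w. indicator {..<v} w * ennreal (gamma_density b (w - t)) *
            ennreal (gamma_density a t) \<partial>lborel) \<partial>lborel)"
  proof (rule nn_integral_cong)
    fix t :: real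
    have "(\<integral>\<^sup>+s. indicator {..<v} (s + t) * ennreal (gamma_density b s) \<partial>lborel) =
          (\<integral>\<^sup>+w. indicator {..<v} w * ennreal (gamma_density b (w - t)) \<partial>lborel)"
      by (subst nn_integral_real_affine [where c = 1 and t = "- t"]) simp_all
    then show "(\<integral>\<^sup>+s. indicator {..<v} (s + t) * ennreal (gamma_density b s) \<partial>lborel)
             * ennreal (gamma_density a t) =
        (\<integral>\<^sup>+w. indicator {..<v} w * ennreal (gamma_density b (w - t)) * ennreal (gamma_density a t) \<partial>lborel)"
      by (simp add: nn_integral_multc)
  qed
  also have "\<dots> = (\<integral>\<^sup>+w. (\<integral>\<^sup>+t. indicator {..<v} w * ennreal (gamma_density b (w - t)) *
            ennreal (gamma_density a t) \<partial>lborel) \<partial>lborel)"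
    by (rule lborel_pair.Fubini') measurable
  also have "\<dots> = (\<integral>\<^sup>+w. indicator {..<v} w * ennreal (gamma_density (a + b) w) \<partial>lborel)"
    by (simp add: nn_integral_cmult mult.assoc mult.commute [of "ennreal (gamma_density b _)"]
          gamma_density_convolution [OF a b])
  finally show ?thesis .
qed

text \<open>The distribution function of the Gamma distribution is the regularised lower incomplete Gamma
  function. The Henstock-Kurzweil integral in \<open>lower_Gamma\<close> converges at 0 also for \<open>a < 1\<close>,
  and it is identified here with a Lebesgue integral.\<close>

lemma gamma_cdf_eq:
  assumes a: "a > 0" and v: "v \<ge> 0"
  shows "(\<integral>\<^sup>+t. indicator {..<v} t * ennreal (gamma_density a t) \<partial>lborel) =
           ennreal (lower_Gamma a v / Gamma a)"
    and "lower_Gamma a v \<ge> 0"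
proof -
  let ?f = "\<lambda>t. t powr (a - 1) * exp (- t)"
  have "(\<lambda>t. t powr (a - 1)) absolutely_integrable_on {0..v}"
    using integrable_on_powr_from_0 [of "a - 1" v] a v
    by (intro nonnegative_absolutely_integrable_1) auto
  then have "(\<lambda>t. exp (- t) * t powr (a - 1)) absolutely_integrable_on {0..v}"
    by (intro absolutely_integrable_bounded_measurable_product_real
              continuous_imp_measurable_on_sets_lebesgue continuous_intros) (auto intro!: boundedI[of _ 1])
  then have "?f integrable_on {0..v}"
    by (simp add: set_lebesgue_integral_eq_integral(1) mult.commute)
  then have I: "(?f has_integral lower_Gamma a v) {0..v}"
    unfolding lower_Gamma_def by (rule integrable_integral)
  show pos: "lower_Gamma a v \<ge> 0"
    using I by (rule has_integral_nonneg) auto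
  have "(\<integral>\<^sup>+t. indicator {..<v} t * ennreal (gamma_density a t) \<partial>lborel) =
        (\<integral>\<^sup>+t. ennreal (indicator {0..v} t * ?f t) * ennreal (1 / Gamma a) \<partial>lborel)"
  proof (rule nn_integral_cong_AE)
    have "AE t in lborel. t \<noteq> v" by (rule AE_lborel_singleton)
    then show "AE t in lborel. indicator {..<v} t * ennreal (gamma_density a t) =
        ennreal (indicator {0..v} t * ?f t) * ennreal (1 / Gamma a)"
      by eventually_elim
         (use a in \<open>auto simp: indicator_def gamma_density_def simp flip: ennreal_mult\<close>)
  qed
  also have "\<dots> = ennreal (lower_Gamma a v) * ennreal (1 / Gamma a)"
    using nn_integral_has_integral_lebesgue [OF _ I] by (subst nn_integral_multc) auto
  also have "\<dots> = ennreal (lower_Gamma a v / Gamma a)"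
    using pos a by (simp flip: ennreal_mult)
  finally show "(\<integral>\<^sup>+t. indicator {..<v} t * ennreal (gamma_density a t) \<partial>lborel) =
           ennreal (lower_Gamma a v / Gamma a)" .
qed

section \<open>Truncated even moments of standard normal vectors\<close>

text \<open>The moment of order \<open>2 * m\<close> of the standard normal distribution.\<close>

definition even_moment :: "nat \<Rightarrow> real" where
  "even_moment m = fact (2 * m) / (2 ^ m * fact m)"

lemma even_moment_nonneg [simp]: "even_moment m \<ge> 0"
  by (simp add: even_moment_def)

lemma even_moment_eq_Gamma: "even_moment m = 2 ^ m * Gamma (real m + 1/2) / sqrt pi"
proof (induction m)
  case 0
  then show ?case by (simp add: even_moment_def Gamma_one_half_real)
next
  case (Suc m)
  have Gamma: "Gamma (real (Suc m) + 1/2) = (real m + 1/2) * Gamma (real m + 1/2)"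
    using Gamma_plus1 [of "real m + 1/2"] nonpos_Ints_nonpos [of "real m + 1/2"]
    by (auto simp: add_ac)
  have "even_moment (Suc m) = (2 * real m + 1) * even_moment m"
  proof -
    have "fact (2 * Suc m) = 2 * (real m + 1) * (2 * real m + 1) * fact (2 * m)"
      by (simp add: algebra_simps)
    then show ?thesis by (simp add: even_moment_def divide_simps)
  qed
  also have "\<dots> = 2 ^ Suc m * ((real m + 1/2) * Gamma (real m + 1/2)) / sqrt pi"
    unfolding Suc by (simp add: algebra_simps)
  finally show ?case unfolding Gamma .
qed

abbreviation std_normal_measure :: "real measure" where
  "std_normal_measure \<equiv> density lborel (\<lambda>x. ennreal (std_normal_density x))"

text \<open>Weighting the standard normal distribution by \<open>x ^ (2 * m)\<close> and pushing it forward along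
  \<open>x \<mapsto> x\<^sup>2 / 2\<close> gives, up to the factor \<open>even_moment m\<close>, the Gamma distribution with shape
  \<open>m + 1/2\<close>. By symmetry it suffices to integrate over \<open>x \<ge> 0\<close>, where the substitution
  \<open>s = x\<^sup>2 / 2\<close> is monotone.\<close>

lemma std_normal_truncated_moment:
  "(\<integral>\<^sup>+x. indicator {..<v} (x\<^sup>2 / 2) * ennreal (x ^ (2 * m)) \<partial>std_normal_measure) =
     ennreal (even_moment m) *
       (\<integral>\<^sup>+s. indicator {..<v} s * ennreal (gamma_density (real m + 1/2) s) \<partial>lborel)"
proof (cases "v > 0")
  case False
  have "indicator {..<v} (x\<^sup>2 / 2) = (0 :: ennreal)" for x :: real
  proof -
    have "0 \<le> x\<^sup>2 / 2" by simp
    then have "\<not> x\<^sup>2 / 2 < v" using False by linarith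
    then show ?thesis by (simp add: indicator_def)
  qed
  moreover have "indicator {..<v} s * ennreal (gamma_density (real m + 1/2) s) = 0" for s
    using False by (auto simp: indicator_def gamma_density_def)
  ultimately show ?thesis by (simp only: mult_zero_left mult_zero_right nn_integral_const)
next
  case True
  define b where "b = sqrt (2 * v)"
  have b: "b > 0" "b\<^sup>2 / 2 = v" using True by (auto simp: b_def)
  let ?g = "gamma_density (real m + 1/2)"
  let ?h = "\<lambda>x. std_normal_density x * x ^ (2 * m)"
  \<comment> \<open>The pulled-back Gamma density. The factor 2 accounts for the two preimages of \<open>x\<^sup>2 / 2\<close>.\<close>
  have h: "even_moment m * (?g (x\<^sup>2 / 2) * x) = 2 * ?h x" if "x > 0" for x
  proof -
    have "(x\<^sup>2 / 2) powr (real m + 1/2 - 1) = (x\<^sup>2 / 2) ^ m / (x / sqrt 2)"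
      using that by (simp add: powr_diff powr_add powr_realpow powr_half_sqrt real_sqrt_divide)
    then have eq: "2 ^ m * (x\<^sup>2 / 2) powr (real m + 1/2 - 1) * x = sqrt 2 * x ^ (2 * m)"
      using that by (simp add: power_divide field_simps flip: power_mult)
    have "Gamma (real m + 1/2) \<noteq> 0"
      by (rule less_imp_neq [OF Gamma_real_pos, symmetric]) simp
    then have "even_moment m * (?g (x\<^sup>2 / 2) * x) =
        (2 ^ m * (x\<^sup>2 / 2) powr (real m + 1/2 - 1) * x) * exp (- (x\<^sup>2 / 2)) / sqrt pi"
      using that unfolding even_moment_eq_Gamma gamma_density_def by simp
    also have "\<dots> = 2 * ?h x"
      unfolding eq by (simp add: std_normal_density_def real_sqrt_mult field_simps)
    finally show ?thesis .
  qed
  have "ennreal (even_moment m) * (\<integral>\<^sup>+s. indicator {..<v} s * ennreal (?g s) \<partial>lborel) =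
        ennreal (even_moment m) * (\<integral>\<^sup>+s. ennreal (?g s * indicator {0\<^sup>2 / 2..b\<^sup>2 / 2} s) \<partial>lborel)"
  proof (intro arg_cong2[where f = "(*)"] refl nn_integral_cong_AE)
    have "AE s in lborel. s \<noteq> v" by (rule AE_lborel_singleton)
    then show "AE s in lborel. indicator {..<v} s * ennreal (?g s) =
        ennreal (?g s * indicator {0\<^sup>2 / 2..b\<^sup>2 / 2} s)"
      unfolding b by eventually_elim (auto simp: indicator_def gamma_density_def)
  qed
  also have "\<dots> = ennreal (even_moment m) * (\<integral>\<^sup>+x. ennreal (?g (x\<^sup>2 / 2) * x * indicator {0..b} x) \<partial>lborel)"
    using b by (subst nn_integral_substitution [where g' = "\<lambda>x. x"])
       (auto intro!: derivative_eq_intros continuous_intros simp: set_borel_measurable_def)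
  also have "\<dots> = (\<integral>\<^sup>+x. ennreal (even_moment m * (?g (x\<^sup>2 / 2) * x)) * indicator {0..b} x \<partial>lborel)"
    by (subst nn_integral_cmult [symmetric])
       (auto simp: indicator_def gamma_density_nonneg simp flip: ennreal_mult intro!: nn_integral_cong)
  also have "\<dots> = (\<integral>\<^sup>+x. 2 * (ennreal (?h x) * indicator {0..b} x) \<partial>lborel)"
  proof (intro nn_integral_cong_AE)
    have "AE x in lborel. x \<noteq> (0::real)" by (rule AE_lborel_singleton)
    then show "AE x in lborel. ennreal (even_moment m * (?g (x\<^sup>2 / 2) * x)) * indicator {0..b} x
                = 2 * (ennreal (?h x) * indicator {0..b} x)"
      by eventually_elim (use h in \<open>auto simp: indicator_def ennreal_mult\<close>)
  qed
  also have "\<dots> = 2 * (\<integral>\<^sup>+x. ennreal (?h x) * indicator {0..b} x \<partial>lborel)"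
    by (rule nn_integral_cmult) measurable
  also have "\<dots> = (\<integral>\<^sup>+x. ennreal (?h x) * indicator {0..b} x \<partial>lborel)
                + (\<integral>\<^sup>+x. ennreal (?h x) * indicator {-b..0} x \<partial>lborel)"
  proof -
    have "(\<integral>\<^sup>+x. ennreal (?h x) * indicator {-b..0} x \<partial>lborel) =
          (\<integral>\<^sup>+x. ennreal (?h x) * indicator {0..b} x \<partial>lborel)"
      by (subst nn_integral_real_affine [where c = "-1" and t = 0])
         (auto simp: indicator_def normal_density_def intro!: nn_integral_cong)
    then show ?thesis by (simp add: mult_2)
  qed
  also have "\<dots> = (\<integral>\<^sup>+x. ennreal (?h x) * indicator {0..b} x + ennreal (?h x) * indicator {-b..0} x \<partial>lborel)"
    by (rule nn_integral_add [symmetric]) measurable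
  also have "\<dots> = (\<integral>\<^sup>+x. ennreal (std_normal_density x) * (indicator {..<v} (x\<^sup>2 / 2) * ennreal (x ^ (2 * m))) \<partial>lborel)"
  proof (intro nn_integral_cong_AE)
    have "AE x in lborel. x \<noteq> (0::real)" "AE x in lborel. x \<noteq> b" "AE x in lborel. x \<noteq> -b"
      by (rule AE_lborel_singleton)+
    then show "AE x in lborel. ennreal (?h x) * indicator {0..b} x + ennreal (?h x) * indicator {-b..0} x
        = ennreal (std_normal_density x) * (indicator {..<v} (x\<^sup>2 / 2) * ennreal (x ^ (2 * m)))"
    proof eventually_elim
      case (elim x)
      have "x\<^sup>2 / 2 < v \<longleftrightarrow> x\<^sup>2 < b\<^sup>2" using b by auto
      also have "\<dots> \<longleftrightarrow> \<bar>x\<bar> < b" using b abs_le_square_iff [of b x] by (simp flip: not_le)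
      finally have "x\<^sup>2 / 2 < v \<longleftrightarrow> -b < x \<and> x < b" by auto
      then show ?case using elim
        by (auto simp: indicator_def simp flip: ennreal_mult)
    qed
  qed
  also have "\<dots> = (\<integral>\<^sup>+x. indicator {..<v} (x\<^sup>2 / 2) * ennreal (x ^ (2 * m)) \<partial>std_normal_measure)"
    by (subst nn_integral_density) auto
  finally show ?thesis ..
qed

lemma prob_space_std_normal_measure: "prob_space std_normal_measure"
  by (rule prob_space_normal_density) simp

interpretation std_normal: prob_space std_normal_measure
  by (rule prob_space_std_normal_measure)

interpretation std_normal_product: product_sigma_finite "\<lambda>_. std_normal_measure"
  by unfold_locales

text \<open>For a standard normal vector indexed by \<open>J\<close>, the weights \<open>x j ^ (2 * m j)\<close> turn the halved
  squared coordinates into independent Gamma variables with shapes \<open>m j + 1/2\<close>, so that their sum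
  is again Gamma distributed. The induction adds one coordinate \<open>y\<close> at a time. For fixed \<open>y\<close> it
  lowers the threshold \<open>v\<close> to \<open>v - y\<^sup>2 / 2\<close>, which is why \<open>v\<close> must be arbitrary.\<close>

lemma std_normal_vector_truncated_moment:
  assumes "finite J" "J \<noteq> {}"
  shows "(\<integral>\<^sup>+x. indicator {..<v} (\<Sum>j\<in>J. (x j)\<^sup>2 / 2) * (\<Prod>j\<in>J. ennreal (x j ^ (2 * m j)))
            \<partial>(\<Pi>\<^sub>M j\<in>J. std_normal_measure)) =
         (\<Prod>j\<in>J. ennreal (even_moment (m j))) *
           (\<integral>\<^sup>+t. indicator {..<v} t *
                  ennreal (gamma_density (\<Sum>j\<in>J. real (m j) + 1/2) t) \<partial>lborel)"
  using assms
proof (induction J arbitrary: v rule: finite_ne_induct)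
  case (singleton j)
  show ?case
    using std_normal_product.product_nn_integral_singleton
            [of "\<lambda>x. indicator {..<v} (x\<^sup>2 / 2) * ennreal (x ^ (2 * m j))" j]
    by (simp add: std_normal_truncated_moment)
next
  case (insert i J)
  let ?P = "\<lambda>J. \<Pi>\<^sub>M j\<in>J. std_normal_measure"
  let ?T = "\<lambda>x. \<Sum>j\<in>J. (x j)\<^sup>2 / 2" and ?Q = "\<lambda>x. \<Prod>j\<in>J. ennreal (x j ^ (2 * m j))"
  let ?a = "\<Sum>j\<in>J. real (m j) + 1/2" and ?b = "real (m i) + 1/2"
  let ?C = "\<Prod>j\<in>J. ennreal (even_moment (m j))"
  have a: "?a > 0" using insert.hyps by (intro sum_pos) auto
  have "(\<integral>\<^sup>+x. indicator {..<v} (\<Sum>j\<in>insert i J. (x j)\<^sup>2 / 2) *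
            (\<Prod>j\<in>insert i J. ennreal (x j ^ (2 * m j))) \<partial>?P (insert i J)) =
        (\<integral>\<^sup>+y. (\<integral>\<^sup>+x. indicator {..<v} (\<Sum>j\<in>insert i J. ((x(i := y)) j)\<^sup>2 / 2) *
            (\<Prod>j\<in>insert i J. ennreal ((x(i := y)) j ^ (2 * m j))) \<partial>?P J) \<partial>std_normal_measure)"
    using insert.hyps by (intro std_normal_product.product_nn_integral_insert_rev) auto
  also have "\<dots> = (\<integral>\<^sup>+y. (\<integral>\<^sup>+x. indicator {..<v - y\<^sup>2 / 2} (?T x) * ?Q x *
            ennreal (y ^ (2 * m i)) \<partial>?P J) \<partial>std_normal_measure)"
  proof (intro nn_integral_cong)
    fix x and y :: real
    have "(x(i := y)) j = x j" if "j \<in> J" for j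
      using that insert.hyps by auto
    then have "(\<Sum>j\<in>J. ((x(i := y)) j)\<^sup>2 / 2) = ?T x"
      and "(\<Prod>j\<in>J. ennreal ((x(i := y)) j ^ (2 * m j))) = ?Q x"
      by simp_all
    then show "indicator {..<v} (\<Sum>j\<in>insert i J. ((x(i := y)) j)\<^sup>2 / 2) *
            (\<Prod>j\<in>insert i J. ennreal ((x(i := y)) j ^ (2 * m j))) =
          indicator {..<v - y\<^sup>2 / 2} (?T x) * ?Q x * ennreal (y ^ (2 * m i))"
      using insert.hyps by (auto simp: indicator_def mult_ac)
  qed
  also have "\<dots> = (\<integral>\<^sup>+y. ?C * (\<integral>\<^sup>+t. indicator {..<v - y\<^sup>2 / 2} t * ennreal (gamma_density ?a t) \<partial>lborel)
            * ennreal (y ^ (2 * m i)) \<partial>std_normal_measure)"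
    by (intro nn_integral_cong, subst nn_integral_multc) (auto simp: insert.IH)
  also have "\<dots> = ?C * (\<integral>\<^sup>+y. (\<integral>\<^sup>+t. indicator {..<v} (y\<^sup>2 / 2 + t) * ennreal (y ^ (2 * m i)) *
            ennreal (gamma_density ?a t) \<partial>lborel)
             \<partial>std_normal_measure)"
  proof (subst nn_integral_cmult [symmetric], measurable, intro nn_integral_cong)
    fix y :: real
    have "(\<integral>\<^sup>+t. indicator {..<v} (y\<^sup>2 / 2 + t) * ennreal (y ^ (2 * m i)) *
            ennreal (gamma_density ?a t) \<partial>lborel)
      = (\<integral>\<^sup>+t. indicator {..<v - y\<^sup>2 / 2} t * ennreal (gamma_density ?a t) * ennreal (y ^ (2 * m i)) \<partial>lborel)"
      by (intro nn_integral_cong) (auto simp: indicator_def mult_ac)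
    then show "?C * (\<integral>\<^sup>+t. indicator {..<v - y\<^sup>2 / 2} t * ennreal (gamma_density ?a t) \<partial>lborel)
            * ennreal (y ^ (2 * m i)) =
        ?C * (\<integral>\<^sup>+t. indicator {..<v} (y\<^sup>2 / 2 + t) * ennreal (y ^ (2 * m i)) *
            ennreal (gamma_density ?a t) \<partial>lborel)"
      unfolding mult.assoc [of ?C] by (simp add: nn_integral_multc)
  qed
  also have "\<dots> = ?C * (\<integral>\<^sup>+t. (\<integral>\<^sup>+y. indicator {..<v} (y\<^sup>2 / 2 + t) * ennreal (y ^ (2 * m i)) *
            ennreal (gamma_density ?a t)
             \<partial>std_normal_measure) \<partial>lborel)"
  proof -
    interpret pair_sigma_finite std_normal_measure "lborel :: real measure"
      by (intro pair_sigma_finite.intro std_normal.sigma_finite_measure_axioms lborel.sigma_finite_measure_axioms)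
    show ?thesis by (subst Fubini') auto
  qed
  also have "\<dots> = ?C * (\<integral>\<^sup>+t. ennreal (even_moment (m i)) *
      ((\<integral>\<^sup>+s. indicator {..<v} (s + t) * ennreal (gamma_density ?b s) \<partial>lborel) *
        ennreal (gamma_density ?a t)) \<partial>lborel)"
  proof (intro arg_cong2 [where f = "(*)"] refl nn_integral_cong)
    fix t :: real
    have ind: "indicator {..<v} (s + t) = (indicator {..<v - t} s :: ennreal)" for s
      by (auto simp: indicator_def)
    show "(\<integral>\<^sup>+y. indicator {..<v} (y\<^sup>2 / 2 + t) * ennreal (y ^ (2 * m i)) *
            ennreal (gamma_density ?a t)
             \<partial>std_normal_measure) = ennreal (even_moment (m i)) *
      ((\<integral>\<^sup>+s. indicator {..<v} (s + t) * ennreal (gamma_density ?b s) \<partial>lborel) *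
        ennreal (gamma_density ?a t))"
      unfolding ind
      by (subst nn_integral_multc) (auto simp: std_normal_truncated_moment mult.assoc)
  qed
  also have "\<dots> = ?C * (ennreal (even_moment (m i)) *
        (\<integral>\<^sup>+t. indicator {..<v} t * ennreal (gamma_density (?a + ?b) t) \<partial>lborel))"
    by (subst nn_integral_cmult, measurable, subst gamma_cdf_convolution [OF a]) auto
  also have "\<dots> = (\<Prod>j\<in>insert i J. ennreal (even_moment (m j))) *
           (\<integral>\<^sup>+t. indicator {..<v} t *
                  ennreal (gamma_density (\<Sum>j\<in>insert i J. real (m j) + 1/2) t) \<partial>lborel)"
    using insert.hyps by (simp add: mult_ac add_ac)
  finally show ?case .
qed

section \<open>Expectations of even Hermite polynomials\<close>

lemma hermite_coeff_times_even_moment: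
  assumes "r \<le> n"
  shows "hermite_coeff n r * even_moment (n - r) =
           (-1) ^ r / 2 ^ n * (fact (2 * n) / (fact r * fact (n - r)))"
proof -
  have "(2::real) ^ n = 2 ^ r * 2 ^ (n - r)" using assms by (simp flip: power_add)
  then show ?thesis by (simp add: hermite_coeff_def even_moment_def)
qed

text \<open>A Hermite polynomial of positive degree is orthogonal to the constant 1. In terms of
  coefficients and moments this is the alternating sum of a row of Pascal's triangle.\<close>

lemma sum_hermite_coeff_even_moment:
  assumes "n > 0"
  shows "(\<Sum>r=0..n. hermite_coeff n r * even_moment (n - r)) = 0"
proof -
  have "(\<Sum>r=0..n. hermite_coeff n r * even_moment (n - r)) =
        (\<Sum>r\<le>n. fact (2 * n) / (2 ^ n * fact n) * ((-1) ^ r * real (n choose r)))"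
    unfolding atLeast0AtMost
    by (intro sum.cong) (auto simp: hermite_coeff_times_even_moment binomial_fact)
  also have "\<dots> = 0"
    using choose_alternating_sum [of n, where 'a = real] assms
    by (simp only: sum_distrib_left [symmetric] mult_zero_right)
  finally show ?thesis .
qed

lemma has_bochner_integral_even_moment:
  "has_bochner_integral std_normal_measure (\<lambda>x. x ^ (2 * m)) (even_moment m)"
  using std_normal_moment_even [of m]
  by (intro has_bochner_integral_density) (auto simp: even_moment_def)

lemma hermite_even_measurable [measurable]: "hermite (2 * n) \<in> borel_measurable borel"
  unfolding hermite_even_expansion [abs_def] by measurable

lemma has_bochner_integral_hermite_even:
  assumes "n > 0"
  shows "has_bochner_integral std_normal_measure (hermite (2 * n)) 0"
proof -
  have "has_bochner_integral std_normal_measure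
          (\<lambda>x. \<Sum>r=0..n. hermite_coeff n r * x ^ (2 * (n - r)))
          (\<Sum>r=0..n. hermite_coeff n r * even_moment (n - r))"
    by (intro has_bochner_integral_sum has_bochner_integral_mult_right has_bochner_integral_even_moment)
  then show ?thesis
    using assms by (simp add: hermite_even_expansion [abs_def]
      sum_hermite_coeff_even_moment)
qed

section \<open>The coefficients\<close>

text \<open>The complementary event: the full moment is the product of the one-dimensional moments, and
  the truncated one is subtracted.\<close>

lemma std_normal_vector_tail_moment:
  fixes m :: "'i \<Rightarrow> nat" and u :: real
  assumes J: "finite J" "J \<noteq> {}" and u: "u > 0"
  defines "a \<equiv> (\<Sum>j\<in>J. real (m j) + 1/2)"
  shows "has_bochner_integral (\<Pi>\<^sub>M j\<in>J. std_normal_measure)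
           (\<lambda>x. indicator {x. (\<Sum>j\<in>J. (x j)\<^sup>2) \<ge> u} x * (\<Prod>j\<in>J. x j ^ (2 * m j)))
           ((\<Prod>j\<in>J. even_moment (m j)) * (1 - lower_Gamma a (u / 2) / Gamma a))"
proof -
  let ?P = "\<Pi>\<^sub>M j\<in>J. std_normal_measure"
  let ?Q = "\<lambda>x. \<Prod>j\<in>J. x j ^ (2 * m j)" and ?C = "\<Prod>j\<in>J. even_moment (m j)"
  let ?F = "lower_Gamma a (u / 2) / Gamma a"
  have a: "a > 0" unfolding a_def using J by (intro sum_pos) auto
  have Q: "?Q x \<ge> 0" for x :: "'i \<Rightarrow> real" by (intro prod_nonneg) auto
  have C: "?C \<ge> 0" by (intro prod_nonneg) auto
  have F: "?F \<ge> 0" using gamma_cdf_eq(2) [OF a, of "u / 2"] u a by auto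
  have "has_bochner_integral ?P ?Q ?C"
  proof (unfold has_bochner_integral_iff, intro conjI)
    show "integrable ?P ?Q"
      using J has_bochner_integral_even_moment
      by (intro std_normal_product.product_integrable_prod) (auto simp: has_bochner_integral_iff)
    show "integral\<^sup>L ?P ?Q = ?C"
      using J has_bochner_integral_even_moment
      by (subst std_normal_product.product_integral_prod) (auto simp: has_bochner_integral_iff)
  qed
  moreover have "has_bochner_integral ?P
      (\<lambda>x. indicator {..<u / 2} (\<Sum>j\<in>J. (x j)\<^sup>2 / 2) * ?Q x) (?C * ?F)"
  proof (rule has_bochner_integral_nn_integral)
    have "(\<integral>\<^sup>+x. ennreal (indicator {..<u / 2} (\<Sum>j\<in>J. (x j)\<^sup>2 / 2) * ?Q x) \<partial>?P) =
        (\<integral>\<^sup>+x. indicator {..<u / 2} (\<Sum>j\<in>J. (x j)\<^sup>2 / 2) * (\<Prod>j\<in>J. ennreal (x j ^ (2 * m j))) \<partial>?P)"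
      by (intro nn_integral_cong) (auto simp: indicator_def prod_ennreal)
    also have "\<dots> = ennreal ?C * ennreal ?F"
      unfolding std_normal_vector_truncated_moment [OF J]
      using gamma_cdf_eq(1) [OF a, of "u / 2"] u by (simp add: prod_ennreal a_def)
    also have "\<dots> = ennreal (?C * ?F)" by (rule ennreal_mult [OF C F, symmetric])
    finally show "(\<integral>\<^sup>+x. ennreal (indicator {..<u / 2} (\<Sum>j\<in>J. (x j)\<^sup>2 / 2) * ?Q x) \<partial>?P) = ennreal (?C * ?F)" .
  qed (use mult_nonneg_nonneg [OF C F] Q in auto)
  ultimately have "has_bochner_integral ?P
      (\<lambda>x. ?Q x - indicator {..<u / 2} (\<Sum>j\<in>J. (x j)\<^sup>2 / 2) * ?Q x) (?C - ?C * ?F)"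
    by (rule has_bochner_integral_diff)
  also have "(\<lambda>x. ?Q x - indicator {..<u / 2} (\<Sum>j\<in>J. (x j)\<^sup>2 / 2) * ?Q x) =
     (\<lambda>x. indicator {x. (\<Sum>j\<in>J. (x j)\<^sup>2) \<ge> u} x * ?Q x)"
    by (auto simp: indicator_def simp flip: sum_divide_distrib)
  also have "?C - ?C * ?F = ?C * (1 - ?F)" by (simp add: algebra_simps)
  finally show ?thesis .
qed

text \<open>By independence the joint law of \<open>N 1, \<dots>, N k\<close> is the product of standard normal laws.\<close>

lemma alpha_coeff_eq_product_integral:
  assumes "k \<ge> 1" and "iid_std_normal M k N"
  shows "alpha_coeff M k N n u =
           (\<integral>x. indicator {x. (\<Sum>j=1..k. (x j)\<^sup>2) \<ge> u} x * (\<Prod>j=1..k. hermite (2 * n j) (x j))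
              \<partial>(\<Pi>\<^sub>M j\<in>{1..k}. std_normal_measure))"
proof -
  interpret prob_space M using assms(2) by (simp add: iid_std_normal_def)
  let ?B = "\<Pi>\<^sub>M j\<in>{1..k}. (borel :: real measure)"
  let ?T = "\<lambda>\<omega>. \<lambda>j\<in>{1..k}. N j \<omega>"
  have ind: "indep_vars (\<lambda>_. borel) N {1..k}"
    and dist: "\<And>j. j \<in> {1..k} \<Longrightarrow> distributed M lborel (N j) std_normal_density"
    using assms(2) by (auto simp: iid_std_normal_def)
  have N: "N j \<in> borel_measurable M" if "j \<in> {1..k}" for j
    using dist [OF that] distributed_measurable by fastforce
  have T: "?T \<in> measurable M ?B" using N by measurable
  have marginal: "distr M borel (N j) = std_normal_measure" if "j \<in> {1..k}" for j
  proof -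
    have "distr M borel (N j) = distr M lborel (N j)" by (intro distr_cong) auto
    then show ?thesis using distributed_distr_eq_density [OF dist [OF that]] by simp
  qed
  have "distr M ?B ?T = (\<Pi>\<^sub>M j\<in>{1..k}. distr M borel (N j))"
    using ind N assms(1) by (subst indep_vars_iff_distr_eq_PiM' [symmetric]) auto
  also have "\<dots> = (\<Pi>\<^sub>M j\<in>{1..k}. std_normal_measure)"
    by (intro PiM_cong refl marginal)
  finally have distr: "distr M ?B ?T = (\<Pi>\<^sub>M j\<in>{1..k}. std_normal_measure)" .
  show ?thesis
    unfolding distr [symmetric] alpha_coeff_def
    by (subst integral_distr [OF T]) (auto simp: indicator_def intro!: Bochner_Integration.integral_cong)
qed

text \<open>Expanding the product of Hermite polynomials over the choices \<open>r\<close> of one monomial in each factor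
  reduces the coefficient to tail moments. The resulting formula is valid for \<open>k = 1\<close> as well.\<close>

lemma alpha_coeff_eq_sum:
  assumes "u > 0" and "k \<ge> 1" and "(\<Sum>j=1..k. n j) \<ge> 1" and "iid_std_normal M k N"
  shows "alpha_coeff M k N n u =
           - (\<Sum>r \<in> Pi\<^sub>E {1..k} (\<lambda>j. {0..n j}).
                (\<Prod>j=1..k. hermite_coeff (n j) (r j) * even_moment (n j - r j)) *
                (lower_Gamma (\<Sum>j=1..k. real (n j - r j) + 1/2) (u / 2) /
                 Gamma (\<Sum>j=1..k. real (n j - r j) + 1/2)))"
proof -
  let ?P = "\<Pi>\<^sub>M j\<in>{1..k}. std_normal_measure"
  let ?R = "Pi\<^sub>E {1..k} (\<lambda>j. {0..n j})"
  let ?A = "\<lambda>r. \<Prod>j=1..k. hermite_coeff (n j) (r j)"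
  let ?C = "\<lambda>r. \<Prod>j=1..k. even_moment (n j - r j)"
  let ?F = "\<lambda>r. lower_Gamma (\<Sum>j=1..k. real (n j - r j) + 1/2) (u / 2) /
                 Gamma (\<Sum>j=1..k. real (n j - r j) + 1/2)"
  let ?I = "\<lambda>x. indicator {x. (\<Sum>j=1..k. (x j)\<^sup>2) \<ge> u} x :: real"
  have "(\<lambda>x. ?I x * (\<Prod>j=1..k. hermite (2 * n j) (x j))) =
        (\<lambda>x. \<Sum>r\<in>?R. ?A r * (?I x * (\<Prod>j=1..k. x j ^ (2 * (n j - r j)))))"
  proof
    fix x :: "nat \<Rightarrow> real"
    have "(\<Prod>j=1..k. hermite (2 * n j) (x j)) =
          (\<Sum>r\<in>?R. \<Prod>j=1..k. hermite_coeff (n j) (r j) * x j ^ (2 * (n j - r j)))"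
      unfolding hermite_even_expansion
      by (rule prod_sum_PiE) auto
    then show "?I x * (\<Prod>j=1..k. hermite (2 * n j) (x j)) =
        (\<Sum>r\<in>?R. ?A r * (?I x * (\<Prod>j=1..k. x j ^ (2 * (n j - r j)))))"
      by (simp add: sum_distrib_left prod.distrib mult_ac)
  qed
  moreover have "has_bochner_integral ?P
      (\<lambda>x. \<Sum>r\<in>?R. ?A r * (?I x * (\<Prod>j=1..k. x j ^ (2 * (n j - r j)))))
      (\<Sum>r\<in>?R. ?A r * (?C r * (1 - ?F r)))"
    using assms
    by (intro has_bochner_integral_sum has_bochner_integral_mult_right std_normal_vector_tail_moment) auto
  ultimately have "alpha_coeff M k N n u = (\<Sum>r\<in>?R. ?A r * (?C r * (1 - ?F r)))"
    using assms by (simp add: alpha_coeff_eq_product_integral has_bochner_integral_integral_eq)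
  also have "\<dots> = (\<Sum>r\<in>?R. ?A r * ?C r) - (\<Sum>r\<in>?R. ?A r * ?C r * ?F r)"
    by (simp add: algebra_simps sum_subtractf)
  \<comment> \<open>The product of the expectations, one of which vanishes because some \<open>n j\<close> is positive.\<close>
  also have "(\<Sum>r\<in>?R. ?A r * ?C r) = 0"
  proof -
    have "(\<Sum>r\<in>?R. ?A r * ?C r) =
          (\<Prod>j=1..k. \<Sum>r=0..n j. hermite_coeff (n j) r * even_moment (n j - r))"
      by (subst prod_sum_PiE) (auto simp: prod.distrib)
    moreover obtain j where j: "j \<in> {1..k}" "n j > 0"
    proof -
      have "(\<Sum>j=1..k. n j) \<noteq> 0" using assms(3) by linarith
      then have "\<exists>j\<in>{1..k}. n j \<noteq> 0" by (rule contrapos_np) (simp add: sum.neutral)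
      then show ?thesis using that by blast
    qed
    moreover have "(\<Prod>j=1..k. \<Sum>r=0..n j. hermite_coeff (n j) r * even_moment (n j - r)) = 0"
      using j by (intro prod_zero) (auto intro!: bexI [of _ j] sum_hermite_coeff_even_moment)
    ultimately show ?thesis by simp
  qed
  finally show ?thesis by (simp add: prod.distrib)
qed

text \<open>In dimension one the expectation over \<open>x\<^sup>2 \<ge> u\<close> is minus the expectation over
  \<open>x\<^sup>2 \<le> u\<close>, because the total is 0, and \<open>H\<^bsub>n\<^esub> \<phi>\<close> has the antiderivative
  \<open>- H\<^bsub>n-1\<^esub> \<phi>\<close>, which is an odd function for even \<open>n \<ge> 2\<close>. Hence the fundamental theorem of
  calculus on a compact interval suffices.\<close>

lemma alpha_coeff_1:
  assumes u: "u > 0" and n: "n 1 \<ge> 1" and iid: "iid_std_normal M 1 N"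
  shows "alpha_coeff M 1 N n u = 2 * std_normal_density (sqrt u) * hermite (2 * n 1 - 1) (sqrt u)"
proof -
  define b where "b = sqrt u"
  have b: "b > 0" "b\<^sup>2 = u" using u by (auto simp: b_def)
  let ?H = "hermite (2 * n 1)"
  define G where "G = (\<lambda>x. - (poly (hermite_poly (2 * n 1 - 1)) x * std_normal_density x))"
  have Suc: "2 * n 1 = Suc (2 * n 1 - 1)" using n by simp
  have deriv: "(G has_real_derivative ?H x * std_normal_density x) (at x)" for x
    using DERIV_minus [OF has_real_derivative_hermite_poly_density [of "2 * n 1 - 1" x]] Suc
    unfolding G_def hermite_eq_poly by (simp del: hermite_poly.simps)
  have "isCont (\<lambda>x. ?H x * std_normal_density x) x" for x
    unfolding hermite_eq_poly normal_density_def by (intro continuous_intros) auto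
  then have "has_bochner_integral lborel (\<lambda>x. (?H x * std_normal_density x) * indicator {-b..b} x) (G b - G (- b))"
    using b deriv by (intro has_bochner_integral_FTC_Icc_real) auto
  also have "G b - G (- b) = - (2 * std_normal_density b * hermite (2 * n 1 - 1) b)"
  proof -
    have "poly (hermite_poly (2 * n 1 - 1)) (- b) = - poly (hermite_poly (2 * n 1 - 1)) b"
      using n by (simp add: poly_hermite_poly_minus)
    then show ?thesis by (simp add: G_def hermite_eq_poly normal_density_def)
  qed
  finally have "has_bochner_integral std_normal_measure (\<lambda>x. ?H x * indicator {-b..b} x)
      (- (2 * std_normal_density b * hermite (2 * n 1 - 1) b))"
    by (intro has_bochner_integral_density) (auto simp: mult_ac)
  from has_bochner_integral_diff [OF has_bochner_integral_hermite_even this] n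
  have "has_bochner_integral std_normal_measure (\<lambda>x. ?H x - ?H x * indicator {-b..b} x)
      (2 * std_normal_density b * hermite (2 * n 1 - 1) b)" by simp
  then have "(\<integral>x. ?H x - ?H x * indicator {-b..b} x \<partial>std_normal_measure) =
      2 * std_normal_density b * hermite (2 * n 1 - 1) b"
    by (rule has_bochner_integral_integral_eq)
  moreover have "alpha_coeff M 1 N n u = (\<integral>x. indicator {x. x\<^sup>2 \<ge> u} x * ?H x \<partial>std_normal_measure)"
    using std_normal_product.product_integral_singleton
            [of "\<lambda>x. indicator {x. x\<^sup>2 \<ge> u} x * ?H x" "1::nat"]
    unfolding alpha_coeff_eq_product_integral [OF order_refl iid] by (simp add: indicator_def)
  moreover have "(\<integral>x. indicator {x. x\<^sup>2 \<ge> u} x * ?H x \<partial>std_normal_measure) =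
      (\<integral>x. ?H x - ?H x * indicator {-b..b} x \<partial>std_normal_measure)"
  proof (rule integral_cong_AE)
    have "AE x in lborel. x \<noteq> b" "AE x in lborel. x \<noteq> -b" by (rule AE_lborel_singleton)+
    then have "AE x in lborel. indicator {x. x\<^sup>2 \<ge> u} x * ?H x = ?H x - ?H x * indicator {-b..b} x"
    proof eventually_elim
      case (elim x)
      have "u \<le> x\<^sup>2 \<longleftrightarrow> b \<le> \<bar>x\<bar>" using b abs_le_square_iff [of b x] by simp
      then show ?case using elim b by (auto simp: indicator_def)
    qed
    then show "AE x in std_normal_measure. indicator {x. x\<^sup>2 \<ge> u} x * ?H x = ?H x - ?H x * indicator {-b..b} x"
      by (subst AE_density) auto
  qed measurable
  ultimately show ?thesis by (simp add: b_def)
qed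

theorem lemma3p3:
  fixes M :: "'a measure" and N :: "nat \<Rightarrow> 'a \<Rightarrow> real"
    and n :: "nat \<Rightarrow> nat" and k q :: nat and u :: real
  assumes "u > 0" and "k \<ge> 1" and "q \<ge> 1"
    and "(\<Sum>j=1..k. n j) = q"
    and "iid_std_normal M k N"
  shows "(k = 1 \<longrightarrow>
           alpha_coeff M k N n u = 2 * std_normal_density (sqrt u) * hermite (2 * n 1 - 1) (sqrt u)) \<and>
         (k \<ge> 2 \<longrightarrow>
           alpha_coeff M k N n u =
             - (\<Sum>r \<in> Pi\<^sub>E {1..k} (\<lambda>j. {0..n j}).
                  (-1) ^ (\<Sum>j=1..k. r j) / (\<Prod>j=1..k. 2 ^ n j) *
                  ((\<Prod>j=1..k. fact (2 * n j)) / (\<Prod>j=1..k. fact (r j) * fact (n j - r j))) *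
                  (lower_Gamma (real k / 2 + (\<Sum>j=1..k. real (n j) - real (r j))) (u / 2) /
                   Gamma (real k / 2 + (\<Sum>j=1..k. real (n j) - real (r j))))))"
proof (intro conjI impI)
  assume "k = 1"
  then show "alpha_coeff M k N n u =
      2 * std_normal_density (sqrt u) * hermite (2 * n 1 - 1) (sqrt u)"
    using assms alpha_coeff_1 [of u n M N] by simp
next
  have "(\<Prod>j=1..k. hermite_coeff (n j) (r j) * even_moment (n j - r j)) =
      (-1) ^ (\<Sum>j=1..k. r j) / (\<Prod>j=1..k. 2 ^ n j) *
      ((\<Prod>j=1..k. fact (2 * n j)) / (\<Prod>j=1..k. fact (r j) * fact (n j - r j)))"
    and "(\<Sum>j=1..k. real (n j - r j) + 1/2) = real k / 2 + (\<Sum>j=1..k. real (n j) - real (r j))"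
    if "r \<in> Pi\<^sub>E {1..k} (\<lambda>j. {0..n j})" for r
  proof -
    have le: "r j \<le> n j" if "j \<in> {1..k}" for j
      using \<open>r \<in> _\<close> that by (auto simp: PiE_def Pi_def)
    have "(\<Prod>j=1..k. hermite_coeff (n j) (r j) * even_moment (n j - r j)) =
          (\<Prod>j=1..k. (-1) ^ r j / 2 ^ n j * (fact (2 * n j) / (fact (r j) * fact (n j - r j))))"
      by (intro prod.cong refl hermite_coeff_times_even_moment le)
    then show "(\<Prod>j=1..k. hermite_coeff (n j) (r j) * even_moment (n j - r j)) =
      (-1) ^ (\<Sum>j=1..k. r j) / (\<Prod>j=1..k. 2 ^ n j) *
      ((\<Prod>j=1..k. fact (2 * n j)) / (\<Prod>j=1..k. fact (r j) * fact (n j - r j)))"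
      by (simp only: prod.distrib prod_dividef power_sum)
    have "(\<Sum>j=1..k. real (n j - r j) + 1/2) = (\<Sum>j=1..k. (real (n j) - real (r j)) + 1/2)"
      using le by (intro sum.cong) (auto simp: of_nat_diff)
    then show "(\<Sum>j=1..k. real (n j - r j) + 1/2) = real k / 2 + (\<Sum>j=1..k. real (n j) - real (r j))"
      by (simp add: sum.distrib)
  qed
  then show "alpha_coeff M k N n u =
             - (\<Sum>r \<in> Pi\<^sub>E {1..k} (\<lambda>j. {0..n j}).
                  (-1) ^ (\<Sum>j=1..k. r j) / (\<Prod>j=1..k. 2 ^ n j) *
                  ((\<Prod>j=1..k. fact (2 * n j)) / (\<Prod>j=1..k. fact (r j) * fact (n j - r j))) *
                  (lower_Gamma (real k / 2 + (\<Sum>j=1..k. real (n j) - real (r j))) (u / 2) /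
                   Gamma (real k / 2 + (\<Sum>j=1..k. real (n j) - real (r j)))))"
    using assms by (subst alpha_coeff_eq_sum) simp_all
qed

end
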